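(* A three-dimensional non-unimodular Lie group $G$ equipped with a left-invariant Lorentzian metric is a non-trivial homogeneous Ricci soliton if and only if its Lie algebra is of type IV.3, i.e. admits a basis $\{e_1,e_2,e_3\}$ with $\langle e_1,e_1\rangle=1$, $\langle e_2,e_3\rangle=-1$, all other inner products of basis vectors zero, and $$[e_1,e_2]=0,\quad [e_1,e_3]=\alpha e_1+\beta e_2,\quad [e_2,e_3]=\gamma e_1+\delta e_2,\qquad \alpha+\delta\neq0,\ \alpha\gamma=0,$$ and satisfies $\alpha\neq0=\gamma$. Set $\tilde e_1=e_1$, $\tilde e_2=\frac{1}{\sqrt2}(e_2-e_3)$, $\tilde e_3=\frac{1}{\sqrt2}(e_2+e_3)$. Steady Ricci solitons, defined by the null vector fields $$X=\frac{\alpha^2-\alpha\delta}{2\sqrt2\,\delta}\,(\tilde e_2+\tilde e_3),$$ exist for any choice of $\alpha\neq0,\beta,\delta$. In the special case $\delta=2\alpha$, there exist expanding, steady and shrinking Ricci solitons, defined by the vector fields $$X=-\frac{2\beta\lambda}{\delta^2}\,\tilde e_1-\frac{\delta^4+8(\delta^2-2\beta^2)\lambda}{8\sqrt2\,\delta^3}\,\tilde e_2-\frac{\delta^4-8(\delta^2+2\beta^2)\lambda}{8\sqrt2\,\delta^3}\,\tilde e_3,\qquad \lambda\in\mathbb{R},$$ whose causal character depends on $\lambda$.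
   Context: For a Lie group $G$ with left-invariant Lorentzian metric $g=\langle\cdot,\cdot\rangle$, a homogeneous Ricci soliton is given by a left-invariant vector field $X$ (an element of the Lie algebra) and $\lambda\in\mathbb{R}$ with $\mathcal{L}_Xg+Ric=\lambda g$, where $\mathcal L_X$ is the Lie derivative and $Ric$ the Ricci tensor (sign convention: positive on round spheres); one says that the soliton is defined by $X$. It is shrinking, steady or expanding according to $\lambda>0$, $\lambda=0$, $\lambda<0$. It is non-trivial if $(G,g)$ is neither Einstein nor a product $\mathbb{R}\times N^2(c)$ with $N^2(c)$ of constant curvature. A vector $X$ is spacelike if $\langle X,X\rangle>0$, timelike if $\langle X,X\rangle<0$, and null if $\langle X,X\rangle=0$; this is its causal character. Non-unimodular three-dimensional Lorentzian Lie algebras of non-constant sectional curvature (known classification) admit a basis with $[e_1,e_2]=0$, $[e_1,e_3]=\alpha e_1+\beta e_2$, $[e_2,e_3]=\gamma e_1+\delta e_2$, $\alpha+\delta\neq0$, and one of: (IV.1) the basis is orthonormal with $\langle e_1,e_1\rangle=-1$, $\langle e_2,e_2\rangle=\langle e_3,e_3\rangle=1$, and $\alpha\gamma-\beta\delta=0$; (IV.2) the basis is orthonormal with $\langle e_1,e_1\rangle=\langle e_2,e_2\rangle=1=-\langle e_3,e_3\rangle$, and $\alpha\gamma+\beta\delta=0$; (IV.3) the pseudo-orthonormal case described in the claim.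
   Formalization: δ≠0 is required in the equivalence and for the steady family (for γ=δ=0≠α no soliton exists and X is undefined); type IV.3 is taken with non-constant sectional curvature; the quoted classification into IV.1–IV.3 is assumed of the algebra, since it is not true in general. *)

theory Defs
  imports "HOL-Analysis.Analysis"
begin

text \<open>
  Left-invariant tensor fields on a Lie group are determined by their values on the Lie algebra, so
  a Lie group with a left-invariant metric is represented by its Lie algebra, a real vector space
  with a bracket \<open>br\<close>, together with a scalar product \<open>g\<close>. Left-invariant vector fields are elements
  of the vector space, and inner products of such fields are constant functions on the group.
\<close>

definition lie_bracket :: "('a::real_vector \<Rightarrow> 'a \<Rightarrow> 'a) \<Rightarrow> bool" where
  "lie_bracket br \<longleftrightarrow> bilinear br \<and> (\<forall>x. br x x = 0) \<and>
     (\<forall>x y z. br x (br y z) + br y (br z x) + br z (br x y) = 0)"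

definition basis3 :: "'a::real_vector \<Rightarrow> 'a \<Rightarrow> 'a \<Rightarrow> bool" where
  "basis3 e1 e2 e3 \<longleftrightarrow>
     distinct [e1, e2, e3] \<and> independent {e1, e2, e3} \<and> span {e1, e2, e3} = UNIV"

text \<open>Signature (2,1), for a three-dimensional space.\<close>

definition lorentzian3 :: "('a::real_vector \<Rightarrow> 'a \<Rightarrow> real) \<Rightarrow> bool" where
  "lorentzian3 g \<longleftrightarrow> bilinear g \<and> (\<forall>x y. g x y = g y x) \<and>
     (\<exists>e1 e2 e3. basis3 e1 e2 e3 \<and> g e1 e1 = -1 \<and> g e2 e2 = 1 \<and> g e3 e3 = 1 \<and>
        g e1 e2 = 0 \<and> g e1 e3 = 0 \<and> g e2 e3 = 0)"

text \<open>
  \<open>extend_basis {}\<close> is a fixed basis of the whole space; for linear \<open>f\<close> on a finite-dimensional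
  space the value does not depend on it.
\<close>

definition endo_trace :: "('a::real_vector \<Rightarrow> 'a) \<Rightarrow> real" where
  "endo_trace f =
     (\<Sum>b\<in>extend_basis {}. representation (extend_basis {}) (f b) b)"

definition unimodular :: "('a::real_vector \<Rightarrow> 'a \<Rightarrow> 'a) \<Rightarrow> bool" where
  "unimodular br \<longleftrightarrow> (\<forall>x. endo_trace (br x) = 0)"

text \<open>
  The Levi-Civita connection on left-invariant fields: torsion-free and metric. The derivative of
  \<open>g y z\<close> does not occur in the second condition because \<open>g y z\<close> is constant.
\<close>

definition levi_civita ::
    "('a::real_vector \<Rightarrow> 'a \<Rightarrow> 'a) \<Rightarrow> ('a \<Rightarrow> 'a \<Rightarrow> real) \<Rightarrow> 'a \<Rightarrow> 'a \<Rightarrow> 'a" where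
  "levi_civita br g = (THE D. bilinear D \<and> (\<forall>x y. D x y - D y x = br x y) \<and>
     (\<forall>x y z. g (D x y) z + g y (D x z) = 0))"

definition curvature ::
    "('a::real_vector \<Rightarrow> 'a \<Rightarrow> 'a) \<Rightarrow> ('a \<Rightarrow> 'a \<Rightarrow> real) \<Rightarrow> 'a \<Rightarrow> 'a \<Rightarrow> 'a \<Rightarrow> 'a" where
  "curvature br g x y z = (let D = levi_civita br g in
     D x (D y z) - D y (D x z) - D (br x y) z)"

text \<open>With this choice of signs the Ricci tensor of a round sphere is positive.\<close>

definition ricci ::
    "('a::real_vector \<Rightarrow> 'a \<Rightarrow> 'a) \<Rightarrow> ('a \<Rightarrow> 'a \<Rightarrow> real) \<Rightarrow> 'a \<Rightarrow> 'a \<Rightarrow> real" where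
  "ricci br g y z = endo_trace (\<lambda>x. curvature br g x y z)"

definition nondegenerate_plane :: "('a::real_vector \<Rightarrow> 'a \<Rightarrow> real) \<Rightarrow> 'a \<Rightarrow> 'a \<Rightarrow> bool" where
  "nondegenerate_plane g x y \<longleftrightarrow> g x x * g y y - (g x y)\<^sup>2 \<noteq> 0"

definition sectional_curvature ::
    "('a::real_vector \<Rightarrow> 'a \<Rightarrow> 'a) \<Rightarrow> ('a \<Rightarrow> 'a \<Rightarrow> real) \<Rightarrow> 'a \<Rightarrow> 'a \<Rightarrow> real" where
  "sectional_curvature br g x y =
     g (curvature br g x y y) x / (g x x * g y y - (g x y)\<^sup>2)"

definition constant_sectional_curvature ::
    "('a::real_vector \<Rightarrow> 'a \<Rightarrow> 'a) \<Rightarrow> ('a \<Rightarrow> 'a \<Rightarrow> real) \<Rightarrow> bool" where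
  "constant_sectional_curvature br g \<longleftrightarrow>
     (\<exists>c. \<forall>x y. nondegenerate_plane g x y \<longrightarrow> sectional_curvature br g x y = c)"

definition einstein ::
    "('a::real_vector \<Rightarrow> 'a \<Rightarrow> 'a) \<Rightarrow> ('a \<Rightarrow> 'a \<Rightarrow> real) \<Rightarrow> bool" where
  "einstein br g \<longleftrightarrow> (\<exists>c. \<forall>x y. ricci br g x y = c * g x y)"

text \<open>
  The (local) product of a line and a surface of constant curvature: the line factor is spanned by
  a parallel non-null field \<open>u\<close>, and the other factor is tangent to the orthogonal complement of
  \<open>u\<close>, being totally geodesic, so that its curvature is the sectional curvature of that plane. If the
  surface is not flat, the line factor is the kernel of the Ricci operator, hence left-invariant,
  so it is enough to consider left-invariant \<open>u\<close>; if the surface is flat, the metric is Einstein.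
\<close>

definition product_line_surface ::
    "('a::real_vector \<Rightarrow> 'a \<Rightarrow> 'a) \<Rightarrow> ('a \<Rightarrow> 'a \<Rightarrow> real) \<Rightarrow> bool" where
  "product_line_surface br g \<longleftrightarrow>
     (\<exists>u c. g u u \<noteq> 0 \<and> (\<forall>x. levi_civita br g x u = 0) \<and>
        (\<forall>x y. g x u = 0 \<and> g y u = 0 \<and> nondegenerate_plane g x y \<longrightarrow>
           sectional_curvature br g x y = c))"

text \<open>
  The Lie derivative of \<open>g\<close> on left-invariant fields; the term differentiating the constant
  function \<open>g y z\<close> vanishes.
\<close>

definition lie_derivative_metric ::
    "('a::real_vector \<Rightarrow> 'a \<Rightarrow> 'a) \<Rightarrow> ('a \<Rightarrow> 'a \<Rightarrow> real) \<Rightarrow> 'a \<Rightarrow> 'a \<Rightarrow> 'a \<Rightarrow> real" where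
  "lie_derivative_metric br g X y z = - g (br X y) z - g y (br X z)"

definition ricci_soliton ::
    "('a::real_vector \<Rightarrow> 'a \<Rightarrow> 'a) \<Rightarrow> ('a \<Rightarrow> 'a \<Rightarrow> real) \<Rightarrow> 'a \<Rightarrow> real \<Rightarrow> bool" where
  "ricci_soliton br g X l \<longleftrightarrow>
     (\<forall>y z. lie_derivative_metric br g X y z + ricci br g y z = l * g y z)"

definition shrinking_soliton ::
    "('a::real_vector \<Rightarrow> 'a \<Rightarrow> 'a) \<Rightarrow> ('a \<Rightarrow> 'a \<Rightarrow> real) \<Rightarrow> 'a \<Rightarrow> bool" where
  "shrinking_soliton br g X \<longleftrightarrow> (\<exists>l>0. ricci_soliton br g X l)"

definition steady_soliton ::
    "('a::real_vector \<Rightarrow> 'a \<Rightarrow> 'a) \<Rightarrow> ('a \<Rightarrow> 'a \<Rightarrow> real) \<Rightarrow> 'a \<Rightarrow> bool" where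
  "steady_soliton br g X \<longleftrightarrow> ricci_soliton br g X 0"

definition expanding_soliton ::
    "('a::real_vector \<Rightarrow> 'a \<Rightarrow> 'a) \<Rightarrow> ('a \<Rightarrow> 'a \<Rightarrow> real) \<Rightarrow> 'a \<Rightarrow> bool" where
  "expanding_soliton br g X \<longleftrightarrow> (\<exists>l<0. ricci_soliton br g X l)"

definition nontrivial_homogeneous_soliton ::
    "('a::real_vector \<Rightarrow> 'a \<Rightarrow> 'a) \<Rightarrow> ('a \<Rightarrow> 'a \<Rightarrow> real) \<Rightarrow> bool" where
  "nontrivial_homogeneous_soliton br g \<longleftrightarrow>
     (\<exists>X l. ricci_soliton br g X l) \<and> \<not> einstein br g \<and> \<not> product_line_surface br g"

datatype causal_type = Spacelike | Timelike | Null

definition causal_character :: "('a::real_vector \<Rightarrow> 'a \<Rightarrow> real) \<Rightarrow> 'a \<Rightarrow> causal_type" where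
  "causal_character g X =
     (if g X X > 0 then Spacelike else if g X X < 0 then Timelike else Null)"

definition type_IV_brackets ::
    "('a::real_vector \<Rightarrow> 'a \<Rightarrow> 'a) \<Rightarrow> 'a \<Rightarrow> 'a \<Rightarrow> 'a \<Rightarrow> real \<Rightarrow> real \<Rightarrow> real \<Rightarrow> real \<Rightarrow> bool" where
  "type_IV_brackets br e1 e2 e3 \<alpha> \<beta> \<gamma> \<delta> \<longleftrightarrow> basis3 e1 e2 e3 \<and> br e1 e2 = 0 \<and>
     br e1 e3 = \<alpha> *\<^sub>R e1 + \<beta> *\<^sub>R e2 \<and> br e2 e3 = \<gamma> *\<^sub>R e1 + \<delta> *\<^sub>R e2 \<and> \<alpha> + \<delta> \<noteq> 0"

definition type_IV1 ::
    "('a::real_vector \<Rightarrow> 'a \<Rightarrow> 'a) \<Rightarrow> ('a \<Rightarrow> 'a \<Rightarrow> real) \<Rightarrow> 'a \<Rightarrow> 'a \<Rightarrow> 'a \<Rightarrow>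
      real \<Rightarrow> real \<Rightarrow> real \<Rightarrow> real \<Rightarrow> bool" where
  "type_IV1 br g e1 e2 e3 \<alpha> \<beta> \<gamma> \<delta> \<longleftrightarrow> type_IV_brackets br e1 e2 e3 \<alpha> \<beta> \<gamma> \<delta> \<and>
     g e1 e1 = -1 \<and> g e2 e2 = 1 \<and> g e3 e3 = 1 \<and> g e1 e2 = 0 \<and> g e1 e3 = 0 \<and> g e2 e3 = 0 \<and>
     \<alpha> * \<gamma> - \<beta> * \<delta> = 0"

definition type_IV2 ::
    "('a::real_vector \<Rightarrow> 'a \<Rightarrow> 'a) \<Rightarrow> ('a \<Rightarrow> 'a \<Rightarrow> real) \<Rightarrow> 'a \<Rightarrow> 'a \<Rightarrow> 'a \<Rightarrow>
      real \<Rightarrow> real \<Rightarrow> real \<Rightarrow> real \<Rightarrow> bool" where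
  "type_IV2 br g e1 e2 e3 \<alpha> \<beta> \<gamma> \<delta> \<longleftrightarrow> type_IV_brackets br e1 e2 e3 \<alpha> \<beta> \<gamma> \<delta> \<and>
     g e1 e1 = 1 \<and> g e2 e2 = 1 \<and> g e3 e3 = -1 \<and> g e1 e2 = 0 \<and> g e1 e3 = 0 \<and> g e2 e3 = 0 \<and>
     \<alpha> * \<gamma> + \<beta> * \<delta> = 0"

definition type_IV3 ::
    "('a::real_vector \<Rightarrow> 'a \<Rightarrow> 'a) \<Rightarrow> ('a \<Rightarrow> 'a \<Rightarrow> real) \<Rightarrow> 'a \<Rightarrow> 'a \<Rightarrow> 'a \<Rightarrow>
      real \<Rightarrow> real \<Rightarrow> real \<Rightarrow> real \<Rightarrow> bool" where
  "type_IV3 br g e1 e2 e3 \<alpha> \<beta> \<gamma> \<delta> \<longleftrightarrow> type_IV_brackets br e1 e2 e3 \<alpha> \<beta> \<gamma> \<delta> \<and>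
     g e1 e1 = 1 \<and> g e2 e2 = 0 \<and> g e3 e3 = 0 \<and> g e1 e2 = 0 \<and> g e1 e3 = 0 \<and> g e2 e3 = -1 \<and>
     \<alpha> * \<gamma> = 0"

text \<open>
  The classification of non-unimodular three-dimensional Lorentzian Lie algebras of non-constant
  sectional curvature, as a property of a given algebra.
\<close>

definition in_classification ::
    "('a::real_vector \<Rightarrow> 'a \<Rightarrow> 'a) \<Rightarrow> ('a \<Rightarrow> 'a \<Rightarrow> real) \<Rightarrow> bool" where
  "in_classification br g \<longleftrightarrow> (\<not> constant_sectional_curvature br g \<longrightarrow>
     (\<exists>e1 e2 e3 \<alpha> \<beta> \<gamma> \<delta>. type_IV1 br g e1 e2 e3 \<alpha> \<beta> \<gamma> \<delta> \<or>
        type_IV2 br g e1 e2 e3 \<alpha> \<beta> \<gamma> \<delta> \<or> type_IV3 br g e1 e2 e3 \<alpha> \<beta> \<gamma> \<delta>))"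

end

theory Submission
  imports Defs
begin

text \<open>
  In each frame of the classification the Koszul formula gives the connection and the Ricci tensor
  as polynomials in the structure constants, and the soliton equation for
  \<open>X = x e\<^sub>1 + y e\<^sub>2 + z e\<^sub>3\<close> becomes a polynomial system that is linear in \<open>x, y, z, \<lambda>\<close>.
  For the orthonormal types it forces \<open>z = 0\<close>, whence \<open>Ric = \<lambda> g\<close>; for type IV.3 it forces
  \<open>\<gamma> = 0\<close>, and then \<open>\<alpha> \<noteq> 0\<close> because the metric is Ricci-flat for \<open>\<alpha> = \<gamma> = 0\<close>. When
  \<open>\<gamma> = 0\<close>, the only component of the Ricci tensor is \<open>Ric(e\<^sub>3, e\<^sub>3) = \<alpha>(\<delta> - \<alpha>)\<close>, so Einstein means
  \<open>\<alpha> = \<delta>\<close>, which is the flat case; and a parallel field satisfies \<open>\<nabla>\<^sub>e\<^sub>1 u = 0\<close>, which makes it a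
  multiple of the null vector \<open>e\<^sub>2\<close>, so that no line splits off.
\<close>

section \<open>Traces of endomorphisms in an arbitrary basis\<close>

lemma representation_linear_sum:
  fixes f :: "'a::real_vector \<Rightarrow> 'a"
  assumes f: "linear f" and B: "independent B" "span B = UNIV" "finite B"
    and C: "independent C" "span C = UNIV"
  shows "representation C (f x) c =
    (\<Sum>b\<in>B. representation B x b * representation C (f b) c)"
proof -
  have "x = (\<Sum>b\<in>B. representation B x b *\<^sub>R b)"
    using B by (intro real_vector.sum_representation_eq [symmetric]) auto
  then have "f x = (\<Sum>b\<in>B. representation B x b *\<^sub>R f b)"
    by (metis (no_types, lifting) f linear_scale linear_sum sum.cong)
  then show ?thesis
    using C by (simp add: real_vector.representation_sum real_vector.representation_scale)
qed

text \<open>This is \<open>tr (P Q) = tr (Q P)\<close>: with \<open>f = id\<close> the previous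
  lemma is the change of coordinates from C to B; swapping the two sums lets the same lemma, now for
  \<open>f\<close> itself, contract over B.\<close>

lemma sum_representation_independent_of_basis:
  fixes f :: "'a::real_vector \<Rightarrow> 'a"
  assumes f: "linear f" and B: "independent B" "span B = UNIV" "finite B"
    and C: "independent C" "span C = UNIV" "finite C"
  shows "(\<Sum>b\<in>B. representation B (f b) b) = (\<Sum>c\<in>C. representation C (f c) c)"
proof -
  have "(\<Sum>b\<in>B. representation B (f b) b) =
      (\<Sum>b\<in>B. \<Sum>c\<in>C. representation C (f b) c * representation B c b)"
    by (intro sum.cong refl representation_linear_sum [OF linear_id C B(1,2), unfolded id_apply])
  also have "\<dots> = (\<Sum>c\<in>C. \<Sum>b\<in>B. representation B c b * representation C (f b) c)"
    unfolding mult.commute [of "representation C _ _"] by (rule sum.swap)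
  also have "\<dots> = (\<Sum>c\<in>C. representation C (f c) c)"
    by (intro sum.cong refl representation_linear_sum [OF f B C(1,2), symmetric])
  finally show ?thesis .
qed

lemma basis3_cases:
  assumes "basis3 e1 e2 e3"
  obtains a b c where "x = a *\<^sub>R e1 + b *\<^sub>R e2 + c *\<^sub>R e3"
proof -
  have "x \<in> span {e1, e2, e3}"
    using assms by (simp add: basis3_def)
  then obtain a b c where "x - a *\<^sub>R e1 - b *\<^sub>R e2 - c *\<^sub>R e3 = 0"
    by (auto simp: span_insert)
  then show thesis
    using that [of a b c] by (simp add: algebra_simps)
qed

text \<open>Pairing with \<open>d1, d2, d3\<close> reads off the coordinates in
  \<open>e1, e2, e3\<close>, so the trace needs only values of \<open>g\<close>. The chosen set
  \<open>extend_basis {}\<close> is finite because it is independent and lies in the span of three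
  vectors.\<close>

lemma endo_trace_dual_basis:
  assumes f: "linear f" and g: "bilinear g" and basis: "basis3 e1 e2 e3"
    and dual: "g e1 d1 = 1" "g e2 d1 = 0" "g e3 d1 = 0"
      "g e1 d2 = 0" "g e2 d2 = 1" "g e3 d2 = 0"
      "g e1 d3 = 0" "g e2 d3 = 0" "g e3 d3 = (1::real)"
  shows "endo_trace f = g (f e1) d1 + g (f e2) d2 + g (f e3) d3"
proof -
  let ?B = "{e1, e2, e3}"
  have B: "independent ?B" "span ?B = UNIV" "distinct [e1, e2, e3]"
    using basis by (auto simp: basis3_def)
  have E: "independent (extend_basis {} :: 'a set)" "span (extend_basis {} :: 'a set) = UNIV"
    using real_vector.independent_extend_basis real_vector.span_extend_basis independent_empty
    by auto
  have "finite (extend_basis {} :: 'a set)"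
    using real_vector.independent_span_bound [of ?B "extend_basis {}"] E B by simp
  then have "endo_trace f = (\<Sum>b\<in>?B. representation ?B (f b) b)"
    unfolding endo_trace_def
    by (intro sum_representation_independent_of_basis f E B) auto
  then have trace: "endo_trace f = representation ?B (f e1) e1 + representation ?B (f e2) e2
      + representation ?B (f e3) e3"
    using B by simp
  have "representation ?B x e1 = g x d1 \<and> representation ?B x e2 = g x d2 \<and>
      representation ?B x e3 = g x d3" for x
  proof -
    have "x = (\<Sum>b\<in>?B. representation ?B x b *\<^sub>R b)"
      using B by (intro real_vector.sum_representation_eq [symmetric]) auto
    also have "\<dots> = representation ?B x e1 *\<^sub>R e1 + representation ?B x e2 *\<^sub>R e2
        + representation ?B x e3 *\<^sub>R e3"
      using B(3) by simp
    finally have "g x d = g (representation ?B x e1 *\<^sub>R e1 + representation ?B x e2 *\<^sub>R e2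
        + representation ?B x e3 *\<^sub>R e3) d" for d
      by simp
    then show ?thesis
      by (simp add: dual bilinear_ladd [OF g] bilinear_lmul [OF g])
  qed
  with trace show ?thesis
    by simp
qed

lemma bilinear_eq_basis3:
  fixes f h :: "'a::real_vector \<Rightarrow> 'a \<Rightarrow> real"
  assumes "bilinear f" "bilinear h" "basis3 e1 e2 e3"
    and "\<forall>x\<in>{e1, e2, e3}. \<forall>y\<in>{e1, e2, e3}. f x y = h x y"
  shows "f x y = h x y"
  using assms bilinear_eq [of f h UNIV "{e1, e2, e3}" UNIV "{e1, e2, e3}" x y]
  by (auto simp: basis3_def)

section \<open>The Levi-Civita connection of a left-invariant Lorentzian metric\<close>

locale lorentzian_lie_algebra =
  fixes br :: "'a::real_vector \<Rightarrow> 'a \<Rightarrow> 'a" and g :: "'a \<Rightarrow> 'a \<Rightarrow> real"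
  assumes lie: "lie_bracket br" and lorentzian: "lorentzian3 g"
begin

abbreviation "D \<equiv> levi_civita br g"
abbreviation "R \<equiv> curvature br g"

lemma bilinear_br: "bilinear br"
  and br_self: "br x x = 0"
  and jacobi: "br x (br y z) + br y (br z x) + br z (br x y) = 0"
  using lie by (auto simp: lie_bracket_def)

lemma bilinear_g: "bilinear g" and g_commute: "g x y = g y x"
  using lorentzian by (auto simp: lorentzian3_def)

lemmas br_simps = bilinear_ladd [OF bilinear_br] bilinear_radd [OF bilinear_br]
  bilinear_lmul [OF bilinear_br] bilinear_rmul [OF bilinear_br]
  bilinear_lneg [OF bilinear_br] bilinear_rneg [OF bilinear_br]
  bilinear_lzero [OF bilinear_br] bilinear_rzero [OF bilinear_br]
  bilinear_lsub [OF bilinear_br] bilinear_rsub [OF bilinear_br] br_self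

lemmas g_simps = bilinear_ladd [OF bilinear_g] bilinear_radd [OF bilinear_g]
  bilinear_lmul [OF bilinear_g] bilinear_rmul [OF bilinear_g]
  bilinear_lneg [OF bilinear_g] bilinear_rneg [OF bilinear_g]
  bilinear_lzero [OF bilinear_g] bilinear_rzero [OF bilinear_g]
  bilinear_lsub [OF bilinear_g] bilinear_rsub [OF bilinear_g]

lemma br_commute: "br x y = - br y x"
proof -
  have "br (x + y) (x + y) = br x y + br y x"
    unfolding bilinear_ladd [OF bilinear_br] bilinear_radd [OF bilinear_br]
    by (simp add: br_self)
  then show ?thesis
    by (simp only: br_self eq_neg_iff_add_eq_0)
qed

lemma nondegenerate:
  assumes "\<And>z. g v z = g w z"
  shows "v = w"
proof -
  obtain e1 e2 e3 where e: "basis3 e1 e2 e3" "g e1 e1 = -1" "g e2 e2 = 1" "g e3 e3 = 1"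
    "g e1 e2 = 0" "g e1 e3 = 0" "g e2 e3 = 0"
    using lorentzian by (auto simp: lorentzian3_def)
  obtain a b c where vw: "v - w = a *\<^sub>R e1 + b *\<^sub>R e2 + c *\<^sub>R e3"
    using basis3_cases [OF e(1)] .
  have z: "g (v - w) z = 0" for z
    using assms by (simp add: g_simps)
  have "a = 0" "b = 0" "c = 0"
    using z [of e1] z [of e2] z [of e3] e(2-)
    by (simp_all add: vw g_simps g_commute [of e2 e1] g_commute [of e3 e1] g_commute [of e3 e2])
  then show ?thesis
    using vw by simp
qed

lemma eq_basis3I:
  assumes "basis3 e1 e2 e3" "g v e1 = g w e1" "g v e2 = g w e2" "g v e3 = g w e3"
  shows "v = w"
proof (rule nondegenerate)
  fix z
  obtain a b c where "z = a *\<^sub>R e1 + b *\<^sub>R e2 + c *\<^sub>R e3"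
    using basis3_cases [OF assms(1)] .
  then show "g v z = g w z"
    by (simp add: g_simps assms)
qed

text \<open>The Koszul formula without its three derivative terms, which vanish because inner
  products of left-invariant fields are constant.\<close>

definition koszul :: "'a \<Rightarrow> 'a \<Rightarrow> 'a \<Rightarrow> real" where
  "koszul x y z = (g (br x y) z - g (br y z) x + g (br z x) y) / 2"

text \<open>Vanishing torsion replaces each bracket by a difference of two \<open>E\<close>-terms.
  Metric compatibility along x, y and z then cancels four of the six terms and makes the other two
  equal.\<close>

lemma koszul_unique:
  assumes "\<forall>x y. E x y - E y x = br x y" and "\<forall>x y z. g (E x y) z + g y (E x z) = 0"
  shows "g (E x y) z = koszul x y z"
proof -
  have t: "g (br x y) z = g (E x y) z - g (E y x) z" for x y z
    using assms(1) by (metis bilinear_g bilinear_lsub)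
  have m: "g (E x y) z = - g (E x z) y" for x y z
    using assms(2) g_commute by (metis add_eq_0_iff2)
  show ?thesis
    using m [of x y z] m [of y x z] m [of z x y]
    unfolding koszul_def t by argo
qed

lemma koszul_torsion: "koszul x y z - koszul y x z = g (br x y) z"
  unfolding koszul_def
  using br_commute [of y x] br_commute [of x z] br_commute [of z y]
  by (simp add: g_simps field_simps)

lemma koszul_metric: "koszul x y z + koszul x z y = 0"
  unfolding koszul_def
  using br_commute [of y x] br_commute [of x z] br_commute [of z y]
  by (simp add: g_simps field_simps)

text \<open>Existence: raising the last index of \<open>koszul\<close> in an orthonormal frame gives
  a connection. Uniqueness: any candidate has the inner products prescribed by
  \<open>koszul\<close>, and \<open>g\<close> is nondegenerate.\<close>

lemma ex1_levi_civita:
  "\<exists>!E. bilinear E \<and> (\<forall>x y. E x y - E y x = br x y) \<and> (\<forall>x y z. g (E x y) z + g y (E x z) = 0)"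
proof -
  obtain e1 e2 e3 where e: "basis3 e1 e2 e3" "g e1 e1 = -1" "g e2 e2 = 1" "g e3 e3 = 1"
    "g e1 e2 = 0" "g e1 e3 = 0" "g e2 e3 = 0"
    using lorentzian by (auto simp: lorentzian3_def)
  \<comment> \<open>The minus sign compensates for \<open>g e1 e1 = -1\<close>.\<close>
  define E where "E x y =
    (- koszul x y e1) *\<^sub>R e1 + koszul x y e2 *\<^sub>R e2 + koszul x y e3 *\<^sub>R e3" for x y
  have E: "g (E x y) z = koszul x y z" for x y z
  proof -
    obtain a b c where z: "z = a *\<^sub>R e1 + b *\<^sub>R e2 + c *\<^sub>R e3"
      using basis3_cases [OF e(1)] .
    have "koszul x y z = a * koszul x y e1 + b * koszul x y e2 + c * koszul x y e3"
      by (simp add: z koszul_def g_simps br_simps field_simps)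
    then show ?thesis
      using e(2-) by (simp add: z E_def g_simps g_commute [of e2 e1] g_commute [of e3 e1]
          g_commute [of e3 e2] algebra_simps)
  qed
  show ?thesis
  proof (rule ex1I [of _ E], intro conjI allI)
    show "bilinear E"
      unfolding bilinear_def
      by (intro conjI allI linearI; rule nondegenerate)
        (simp_all add: g_simps E, simp_all add: koszul_def g_simps br_simps field_simps)
    show "E x y - E y x = br x y" for x y
      by (rule nondegenerate) (simp add: g_simps E koszul_torsion)
    show "g (E x y) z + g y (E x z) = 0" for x y z
      using koszul_metric g_commute [of y "E x z"] by (simp add: E)
    show "E' = E" if "bilinear E' \<and> (\<forall>x y. E' x y - E' y x = br x y) \<and>
        (\<forall>x y z. g (E' x y) z + g y (E' x z) = 0)" for E'
      using that koszul_unique [of E'] by (intro ext nondegenerate) (auto simp: E)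
  qed
qed

lemma levi_civita: "bilinear D \<and> (\<forall>x y. D x y - D y x = br x y) \<and>
    (\<forall>x y z. g (D x y) z + g y (D x z) = 0)"
  unfolding levi_civita_def by (rule theI' [OF ex1_levi_civita])

lemma bilinear_D: "bilinear D"
  and D_torsion: "D x y - D y x = br x y"
  and D_metric: "g (D x y) z = - g y (D x z)"
  using levi_civita by (auto simp: add_eq_0_iff2)

lemma g_D: "g (D x y) z = koszul x y z"
  using levi_civita by (intro koszul_unique) auto

lemmas D_simps = bilinear_ladd [OF bilinear_D] bilinear_radd [OF bilinear_D]
  bilinear_lmul [OF bilinear_D] bilinear_rmul [OF bilinear_D]
  bilinear_lneg [OF bilinear_D] bilinear_rneg [OF bilinear_D]
  bilinear_lzero [OF bilinear_D] bilinear_rzero [OF bilinear_D]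
  bilinear_lsub [OF bilinear_D] bilinear_rsub [OF bilinear_D]

section \<open>Symmetries of the curvature tensor\<close>

lemma R_eq: "R x y z = D x (D y z) - D y (D x z) - D (br x y) z"
  by (simp add: curvature_def Let_def)

lemma R_skew: "R x y z = - R y x z"
  using br_commute [of y x] by (simp add: R_eq D_simps)

lemma g_R_skew: "g (R x y z) w = - g (R x y w) z"
  by (simp add: R_eq g_simps D_metric g_commute [of z])

text \<open>Two uses of vanishing torsion collapse the cyclic sum to the Jacobi expression: first
  inside the outer derivatives, then between these and the bracket terms.\<close>

lemma bianchi: "R x y z + R y z x + R z x y = 0"
proof -
  have "R x y z + R y z x + R z x y =
      D x (D y z - D z y) + D y (D z x - D x z) + D z (D x y - D y x)
      - D (br y z) x - D (br z x) y - D (br x y) z"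
    by (simp add: R_eq D_simps)
  also have "\<dots> = D x (br y z) + D y (br z x) + D z (br x y)
      - D (br y z) x - D (br z x) y - D (br x y) z"
    by (simp only: D_torsion)
  also have "\<dots> = (D x (br y z) - D (br y z) x) + (D y (br z x) - D (br z x) y)
      + (D z (br x y) - D (br x y) z)"
    by simp
  also have "\<dots> = 0"
    unfolding D_torsion by (rule jacobi)
  finally show ?thesis .
qed

text \<open>A linear combination of the Bianchi identities for the four cyclic shifts of x, y, z, w,
  combined with skew-symmetry in the first and in the last two slots.\<close>

lemma g_R_pair_commute: "g (R x y z) w = g (R z w x) y"
proof -
  have b: "g (R x y z) w + g (R y z x) w + g (R z x y) w = 0" for x y z w
    using bianchi [of x y z] by (metis bilinear_g bilinear_ladd bilinear_lzero)
  have s: "g (R x y z) w = - g (R y x z) w" for x y z w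
    by (subst R_skew) (simp add: g_simps)
  show ?thesis
    using b [of x y z w] b [of y z w x] b [of z w x y] b [of w x y z]
      s [of z x y w] s [of w y z x] s [of x z w y] s [of y w x z] s [of w z x y] s [of y x z w]
      g_R_skew [of y z x w] g_R_skew [of x y z w] g_R_skew [of z x y w] g_R_skew [of y z w x]
      g_R_skew [of z w x y] g_R_skew [of w y z x] g_R_skew [of w x y z] g_R_skew [of x z w y]
      g_R_skew [of y w x z]
    by linarith
qed

section \<open>The Ricci tensor and tests on a basis\<close>

lemma linear_R: "linear (\<lambda>x. R x y z)"
  by (intro linearI) (simp_all add: R_eq br_simps D_simps algebra_simps)

lemma ricci_dual_basis:
  assumes "basis3 e1 e2 e3"
    and "g e1 d1 = 1" "g e2 d1 = 0" "g e3 d1 = 0"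
      "g e1 d2 = 0" "g e2 d2 = 1" "g e3 d2 = 0"
      "g e1 d3 = 0" "g e2 d3 = 0" "g e3 d3 = 1"
  shows "ricci br g y z = g (R e1 y z) d1 + g (R e2 y z) d2 + g (R e3 y z) d3"
  unfolding ricci_def
  by (rule endo_trace_dual_basis [OF linear_R bilinear_g assms])

text \<open>Writing the trace in an orthonormal frame makes every summand visibly bilinear. This
  reduces the Einstein and soliton equations to finitely many equations on a frame.\<close>

lemma bilinear_ricci: "bilinear (ricci br g)"
proof -
  obtain e1 e2 e3 where e: "basis3 e1 e2 e3" "g e1 e1 = -1" "g e2 e2 = 1" "g e3 e3 = 1"
    "g e1 e2 = 0" "g e1 e3 = 0" "g e2 e3 = 0"
    using lorentzian by (auto simp: lorentzian3_def)
  have "ricci br g y z = g (R e1 y z) (- e1) + g (R e2 y z) e2 + g (R e3 y z) e3" for y z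
    using e by (intro ricci_dual_basis)
      (auto simp: g_simps g_commute [of e2 e1] g_commute [of e3 e1] g_commute [of e3 e2])
  then have "ricci br g = (\<lambda>y z. g (R e1 y z) (- e1) + g (R e2 y z) e2 + g (R e3 y z) e3)"
    by blast
  then show ?thesis
    unfolding bilinear_def
    by (intro conjI allI linearI)
      (simp_all add: R_eq br_simps D_simps g_simps algebra_simps)
qed

lemma einsteinI:
  assumes "basis3 e1 e2 e3"
    and "\<forall>x\<in>{e1, e2, e3}. \<forall>y\<in>{e1, e2, e3}. ricci br g x y = c * g x y"
  shows "einstein br g"
proof -
  have "bilinear (\<lambda>x y. c * g x y)"
    unfolding bilinear_def by (intro conjI allI linearI) (simp_all add: g_simps algebra_simps)
  then show ?thesis
    unfolding einstein_def
    using bilinear_eq_basis3 [OF bilinear_ricci _ assms(1)] assms(2) by blast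
qed

lemma ricci_solitonI:
  assumes "basis3 e1 e2 e3"
    and "\<forall>x\<in>{e1, e2, e3}. \<forall>y\<in>{e1, e2, e3}.
      lie_derivative_metric br g X x y + ricci br g x y = l * g x y"
  shows "ricci_soliton br g X l"
proof -
  have "bilinear (\<lambda>x y. l * g x y)"
    unfolding bilinear_def by (intro conjI allI linearI) (simp_all add: g_simps algebra_simps)
  moreover have "bilinear (\<lambda>x y. lie_derivative_metric br g X x y + ricci br g x y)"
    using bilinear_ladd [OF bilinear_ricci] bilinear_radd [OF bilinear_ricci]
      bilinear_lmul [OF bilinear_ricci] bilinear_rmul [OF bilinear_ricci]
    unfolding bilinear_def lie_derivative_metric_def
    by (intro conjI allI linearI) (simp_all add: g_simps br_simps algebra_simps)
  ultimately show ?thesis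
    unfolding ricci_soliton_def
    using bilinear_eq_basis3 [OF _ _ assms(1)] assms(2) by blast
qed

section \<open>Constant curvature implies Einstein\<close>

lemma g_R_self_left: "g (R x x z) w = 0"
  by (simp add: R_eq br_simps D_simps g_simps)

lemma g_R_self_right: "g (R x y z) z = 0"
  using g_R_skew [of x y z z] by simp

text \<open>For fixed x, constant curvature prescribes the quadratic form
  \<open>g (R x v v) x\<close> on suitable v. Its values at y, z and a combination of both determine
  the mixed term, which is what the off-diagonal Ricci components consist of.\<close>

lemma constant_curvature_polarize:
  assumes const: "\<forall>x y. nondegenerate_plane g x y \<longrightarrow> sectional_curvature br g x y = c"
    and orth: "g x y = 0" "g x z = 0" "g y z = 0"
    and unit: "\<bar>g x x\<bar> = 1" "\<bar>g y y\<bar> = 1" "\<bar>g z z\<bar> = 1"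
  shows "g (R x y y) x = c * (g x x * g y y)" and "g (R x y z) x = 0"
proof -
  have K: "g (R u v v) u = c * (g u u * g v v - (g u v)\<^sup>2)"
    if "g u u * g v v - (g u v)\<^sup>2 \<noteq> 0" for u v
    using const that by (auto simp: nondegenerate_plane_def sectional_curvature_def field_simps)
  show xy: "g (R x y y) x = c * (g x x * g y y)"
    using K [of x y] orth unit by (cases "g x x = 0"; cases "g y y = 0") auto
  have xz: "g (R x z z) x = c * (g x x * g z z)"
    using K [of x z] orth unit by (cases "g x x = 0"; cases "g z z = 0") auto
  \<comment> \<open>The coefficient 2 keeps the vector non-null, whatever the signs of \<open>g y y\<close> and \<open>g z z\<close>.\<close>
  let ?w = "y + 2 *\<^sub>R z"
  have w: "g ?w ?w = g y y + 4 * g z z" "g x ?w = 0"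
    using orth by (simp_all add: g_simps g_commute [of z y])
  have "g y y + 4 * g z z \<noteq> 0"
    using unit by linarith
  then have "g (R x ?w ?w) x = c * (g x x * (g y y + 4 * g z z))"
    using K [of x ?w] unit by (cases "g x x = 0") (auto simp: w)
  moreover have "g (R x ?w ?w) x =
      g (R x y y) x + 2 * g (R x y z) x + 2 * g (R x z y) x + 4 * g (R x z z) x"
    by (simp add: R_eq br_simps D_simps g_simps algebra_simps)
  \<comment> \<open>Pair symmetry makes the two mixed terms equal, so the expansion leaves four
    times the single one sought.\<close>
  moreover have "g (R x z y) x = g (R x y z) x"
    using g_R_pair_commute [of x z y x] R_skew [of y x x] g_R_skew [of x y x z]
    by (simp add: g_simps)
  ultimately show "g (R x y z) x = 0"
    by (simp add: xy xz algebra_simps)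
qed

lemma constant_curvature_imp_einstein:
  assumes "constant_sectional_curvature br g"
  shows "einstein br g"
proof -
  obtain e1 e2 e3 where e: "basis3 e1 e2 e3" "g e1 e1 = -1" "g e2 e2 = 1" "g e3 e3 = 1"
    "g e1 e2 = 0" "g e1 e3 = 0" "g e2 e3 = 0"
    using lorentzian by (auto simp: lorentzian3_def)
  have e': "g e2 e1 = 0" "g e3 e1 = 0" "g e3 e2 = 0"
    using e g_commute by metis+
  obtain c where c: "\<forall>x y. nondegenerate_plane g x y \<longrightarrow> sectional_curvature br g x y = c"
    using assms by (auto simp: constant_sectional_curvature_def)
  have ricci: "ricci br g y z = g (R e1 y z) (- e1) + g (R e2 y z) e2 + g (R e3 y z) e3" for y z
    using e e' by (intro ricci_dual_basis) (auto simp: g_simps)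
  note p = constant_curvature_polarize [OF c]
  \<comment> \<open>The sign is negative exactly for planes containing the timelike
    \<open>e1\<close>. Each diagonal Ricci entry adds two such planes, which gives the Einstein
    constant \<open>2 * c\<close>.\<close>
  have "g (R e1 e2 e2) e1 = - c" "g (R e1 e2 e3) e1 = 0" "g (R e1 e3 e3) e1 = - c"
    "g (R e1 e3 e2) e1 = 0" "g (R e2 e1 e1) e2 = - c" "g (R e2 e1 e3) e2 = 0"
    "g (R e2 e3 e3) e2 = c" "g (R e2 e3 e1) e2 = 0" "g (R e3 e1 e1) e3 = - c"
    "g (R e3 e1 e2) e3 = 0" "g (R e3 e2 e2) e3 = c" "g (R e3 e2 e1) e3 = 0"
    using p [of e1 e2 e3] p [of e1 e3 e2] p [of e2 e1 e3] p [of e2 e3 e1] p [of e3 e1 e2]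
      p [of e3 e2 e1]
    by (simp_all add: e e')
  then show ?thesis
    by (intro einsteinI [OF e(1), of "2 * c"])
      (simp add: ricci bilinear_rneg [OF bilinear_g] e e' g_R_self_left g_R_self_right)
qed

section \<open>Connection and Ricci tensor in the frames of the classification\<close>

lemma type_IV_bracketsD:
  assumes "type_IV_brackets br e1 e2 e3 a b c d"
  shows "br e1 e2 = 0" "br e2 e1 = 0"
    "br e1 e3 = a *\<^sub>R e1 + b *\<^sub>R e2" "br e3 e1 = - (a *\<^sub>R e1 + b *\<^sub>R e2)"
    "br e2 e3 = c *\<^sub>R e1 + d *\<^sub>R e2" "br e3 e2 = - (c *\<^sub>R e1 + d *\<^sub>R e2)"
  using assms br_commute [of e2 e1] br_commute [of e3 e1] br_commute [of e3 e2]
  by (simp_all add: type_IV_brackets_def)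

text \<open>The signature \<open>(p, 1, - p)\<close> is that of type IV.1 for \<open>p = -1\<close> and of type IV.2 for \<open>p = 1\<close>.\<close>

lemma orthonormal_frame_ricci:
  assumes br: "type_IV_brackets br e1 e2 e3 a b c d"
    and p: "p = 1 \<or> p = -1"
    and e: "g e1 e1 = p" "g e2 e2 = 1" "g e3 e3 = - p" "g e1 e2 = 0" "g e1 e3 = 0" "g e2 e3 = 0"
  shows "ricci br g e1 e1 = a * (a + d) + p * (b\<^sup>2 - c\<^sup>2) / 2"
    and "ricci br g e2 e2 = p * d * (a + d) - (b\<^sup>2 - c\<^sup>2) / 2"
    and "ricci br g e3 e3 = - (a\<^sup>2 + d\<^sup>2 + p * (b + p * c)\<^sup>2 / 2)"
    and "ricci br g e1 e2 = a * c + p * (b * d)" and "ricci br g e2 e1 = a * c + p * (b * d)"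
    and "ricci br g e1 e3 = 0" and "ricci br g e3 e1 = 0"
    and "ricci br g e2 e3 = 0" and "ricci br g e3 e2 = 0"
proof -
  have basis: "basis3 e1 e2 e3"
    using br by (simp add: type_IV_brackets_def)
  have e': "g e2 e1 = 0" "g e3 e1 = 0" "g e3 e2 = 0"
    using e g_commute by metis+
  note simps = type_IV_bracketsD [OF br] e e' g_simps br_simps
  have D: "D e1 e1 = a *\<^sub>R e3" "D e1 e2 = ((p * b + c) / 2) *\<^sub>R e3"
    "D e1 e3 = a *\<^sub>R e1 + ((b + p * c) / 2) *\<^sub>R e2"
    "D e2 e1 = ((p * b + c) / 2) *\<^sub>R e3" "D e2 e2 = (p * d) *\<^sub>R e3"
    "D e2 e3 = ((p * b + c) / 2) *\<^sub>R e1 + d *\<^sub>R e2"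
    "D e3 e1 = ((p * c - b) / 2) *\<^sub>R e2" "D e3 e2 = ((p * b - c) / 2) *\<^sub>R e1" "D e3 e3 = 0"
    by (rule eq_basis3I [OF basis]; use p in \<open>auto simp: g_D koszul_def simps\<close>)+
  \<comment> \<open>Since \<open>p * p = 1\<close>, the basis dual to the frame is
    \<open>p e1, e2, - p e3\<close>.\<close>
  have ricci: "ricci br g y z = g (R e1 y z) (p *\<^sub>R e1) + g (R e2 y z) e2
      + g (R e3 y z) (- (p *\<^sub>R e3))" for y z
    using p by (intro ricci_dual_basis basis) (auto simp: simps)
  show "ricci br g e1 e1 = a * (a + d) + p * (b\<^sup>2 - c\<^sup>2) / 2"
    "ricci br g e2 e2 = p * d * (a + d) - (b\<^sup>2 - c\<^sup>2) / 2"
    "ricci br g e3 e3 = - (a\<^sup>2 + d\<^sup>2 + p * (b + p * c)\<^sup>2 / 2)"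
    "ricci br g e1 e2 = a * c + p * (b * d)" "ricci br g e2 e1 = a * c + p * (b * d)"
    "ricci br g e1 e3 = 0" "ricci br g e3 e1 = 0"
    "ricci br g e2 e3 = 0" "ricci br g e3 e2 = 0"
    using p
    by (elim disjE; simp add: ricci R_eq D D_simps simps field_simps power2_eq_square)+
qed

lemma null_frame_connection:
  assumes br: "type_IV_brackets br e1 e2 e3 a b c d"
    and e: "g e1 e1 = 1" "g e2 e2 = 0" "g e3 e3 = 0" "g e1 e2 = 0" "g e1 e3 = 0" "g e2 e3 = -1"
  shows "D e1 e1 = a *\<^sub>R e2" "D e1 e2 = (c / 2) *\<^sub>R e2" "D e1 e3 = a *\<^sub>R e1 - (c / 2) *\<^sub>R e3"
    "D e2 e1 = (c / 2) *\<^sub>R e2" "D e2 e2 = 0" "D e2 e3 = (c / 2) *\<^sub>R e1"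
    "D e3 e1 = - b *\<^sub>R e2 - (c / 2) *\<^sub>R e3" "D e3 e2 = - (c / 2) *\<^sub>R e1 - d *\<^sub>R e2"
    "D e3 e3 = - b *\<^sub>R e1 + d *\<^sub>R e3"
proof -
  have basis: "basis3 e1 e2 e3"
    using br by (simp add: type_IV_brackets_def)
  have e': "g e2 e1 = 0" "g e3 e1 = 0" "g e3 e2 = -1"
    using e g_commute by metis+
  show "D e1 e1 = a *\<^sub>R e2" "D e1 e2 = (c / 2) *\<^sub>R e2" "D e1 e3 = a *\<^sub>R e1 - (c / 2) *\<^sub>R e3"
    "D e2 e1 = (c / 2) *\<^sub>R e2" "D e2 e2 = 0" "D e2 e3 = (c / 2) *\<^sub>R e1"
    "D e3 e1 = - b *\<^sub>R e2 - (c / 2) *\<^sub>R e3" "D e3 e2 = - (c / 2) *\<^sub>R e1 - d *\<^sub>R e2"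
    "D e3 e3 = - b *\<^sub>R e1 + d *\<^sub>R e3"
    by (rule eq_basis3I [OF basis]; simp add: g_D koszul_def type_IV_bracketsD [OF br] e e' g_simps br_simps)+
qed

lemma null_frame_ricci:
  assumes br: "type_IV_brackets br e1 e2 e3 a b c d"
    and e: "g e1 e1 = 1" "g e2 e2 = 0" "g e3 e3 = 0" "g e1 e2 = 0" "g e1 e3 = 0" "g e2 e3 = -1"
  shows "ricci br g e1 e1 = - c\<^sup>2 / 2" "ricci br g e2 e2 = 0"
    "ricci br g e3 e3 = a * d - a\<^sup>2 - b * c"
    "ricci br g e1 e2 = 0" "ricci br g e2 e1 = 0"
    "ricci br g e1 e3 = - a * c" "ricci br g e3 e1 = - a * c"
    "ricci br g e2 e3 = - c\<^sup>2 / 2" "ricci br g e3 e2 = - c\<^sup>2 / 2"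
proof -
  have basis: "basis3 e1 e2 e3"
    using br by (simp add: type_IV_brackets_def)
  have e': "g e2 e1 = 0" "g e3 e1 = 0" "g e3 e2 = -1"
    using e g_commute by metis+
  \<comment> \<open>The null vectors are dual to each other up to sign, because
    \<open>g e2 e3 = -1\<close>.\<close>
  have ricci: "ricci br g y z = g (R e1 y z) e1 + g (R e2 y z) (- e3) + g (R e3 y z) (- e2)" for y z
    by (intro ricci_dual_basis basis) (auto simp: e e' g_simps)
  show "ricci br g e1 e1 = - c\<^sup>2 / 2" "ricci br g e2 e2 = 0"
    "ricci br g e3 e3 = a * d - a\<^sup>2 - b * c"
    "ricci br g e1 e2 = 0" "ricci br g e2 e1 = 0"
    "ricci br g e1 e3 = - a * c" "ricci br g e3 e1 = - a * c"
    "ricci br g e2 e3 = - c\<^sup>2 / 2" "ricci br g e3 e2 = - c\<^sup>2 / 2"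
    by (simp_all add: ricci R_eq null_frame_connection [OF assms] D_simps type_IV_bracketsD [OF br] e e' g_simps
        br_simps field_simps power2_eq_square)
qed

section \<open>The soliton equation in these frames\<close>

lemma orthonormal_frame_soliton_imp_einstein:
  assumes br: "type_IV_brackets br e1 e2 e3 a b c d"
    and p: "p = 1 \<or> p = -1"
    and e: "g e1 e1 = p" "g e2 e2 = 1" "g e3 e3 = - p" "g e1 e2 = 0" "g e1 e3 = 0" "g e2 e3 = 0"
    and orth: "a * c + p * (b * d) = 0"
    and soliton: "ricci_soliton br g X l"
  shows "einstein br g"
proof -
  have basis: "basis3 e1 e2 e3" and ad: "a + d \<noteq> 0"
    using br by (simp_all add: type_IV_brackets_def)
  have e': "g e2 e1 = 0" "g e3 e1 = 0" "g e3 e2 = 0"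
    using e g_commute by metis+
  have pp: "p * p = 1" "p * (p * r) = r" for r
    using p by auto
  obtain x y z where X: "X = x *\<^sub>R e1 + y *\<^sub>R e2 + z *\<^sub>R e3"
    using basis3_cases [OF basis] .
  note ric = orthonormal_frame_ricci [OF br p e]
  have s: "- g (br X u) v - g u (br X v) + ricci br g u v = l * g u v" for u v
    using soliton by (simp add: ricci_soliton_def lie_derivative_metric_def)
  note simps = X type_IV_bracketsD [OF br] e e' g_simps br_simps ric
  have s12: "(b + p * c) * z = 0"
    using s [of e1 e2] orth by (simp add: simps algebra_simps)
  have s11: "2 * p * a * z + ricci br g e1 e1 = l * p"
    using s [of e1 e1] by (simp add: simps algebra_simps)
  have s22: "2 * d * z + ricci br g e2 e2 = l"
    using s [of e2 e2] by (simp add: simps algebra_simps)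
  \<comment> \<open>X does not enter: all brackets lie in the span of \<open>e1\<close> and
    \<open>e2\<close>, which is orthogonal to \<open>e3\<close>.\<close>
  have s33: "ricci br g e3 e3 = - (l * p)"
    using s [of e3 e3] by (simp add: simps)
  \<comment> \<open>By \<open>s12\<close> only \<open>b + p * c = 0\<close> is in question. Then
    \<open>s33\<close> gives \<open>l\<close>, and eliminating it from \<open>s11\<close> and
    \<open>s22\<close> leaves two equations for z. Weighting them by d and a cancels z and forces
    \<open>a = d\<close>; since \<open>a + d\<close> is nonzero, so is a, and \<open>az\<close>
    gives \<open>z = 0\<close>.\<close>
  have "z = 0"
  proof (cases "b + p * c = 0")
    case True
    have bc: "b\<^sup>2 = c\<^sup>2"
      using True p by (auto simp: power2_eq_square add_eq_0_iff2)
    have l: "l * p = a\<^sup>2 + d\<^sup>2"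
      using s33 True by (simp add: ric)
    have "2 * p * a * z + a * (a + d) = a\<^sup>2 + d\<^sup>2"
      using s11 by (simp add: ric bc l)
    then have az: "d * (a - d) = - 2 * p * a * z"
      by (simp add: power2_eq_square algebra_simps)
    have dz: "a * (a - d) = 2 * p * d * z"
    proof -
      have "p * (2 * d * z + p * d * (a + d)) = l * p"
        using s22 by (simp add: ric bc)
      then show ?thesis
        by (simp add: l pp power2_eq_square algebra_simps)
    qed
    have "d * (d * (a - d)) + a * (a * (a - d)) = 0"
      unfolding az dz by simp
    then have "(a\<^sup>2 + d\<^sup>2) * (a - d) = 0"
      by (simp add: power2_eq_square algebra_simps)
    moreover have "a\<^sup>2 + d\<^sup>2 \<noteq> 0"
      using ad by (auto simp: sum_power2_eq_zero_iff)
    ultimately have "a = d"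
      by auto
    then show ?thesis
      using az ad p by auto
  qed (use s12 in simp)
  then show ?thesis
    using s11 s22 s33 orth by (intro einsteinI [OF basis, of l]) (auto simp: e e' ric(4-))
qed

lemma null_frame_soliton_cases:
  assumes br: "type_IV_brackets br e1 e2 e3 a b c d"
    and e: "g e1 e1 = 1" "g e2 e2 = 0" "g e3 e3 = 0" "g e1 e2 = 0" "g e1 e3 = 0" "g e2 e3 = -1"
    and ac: "a * c = 0"
    and soliton: "ricci_soliton br g X l" and "\<not> einstein br g"
  shows "a \<noteq> 0 \<and> c = 0 \<and> d \<noteq> 0"
proof -
  have basis: "basis3 e1 e2 e3" and ad: "a + d \<noteq> 0"
    using br by (simp_all add: type_IV_brackets_def)
  have e': "g e2 e1 = 0" "g e3 e1 = 0" "g e3 e2 = -1"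
    using e g_commute by metis+
  obtain x y z where X: "X = x *\<^sub>R e1 + y *\<^sub>R e2 + z *\<^sub>R e3"
    using basis3_cases [OF basis] .
  note ric = null_frame_ricci [OF br e]
  have s: "- g (br X u) v - g u (br X v) + ricci br g u v = l * g u v" for u v
    using soliton by (simp add: ricci_soliton_def lie_derivative_metric_def)
  note simps = X type_IV_bracketsD [OF br] e e' g_simps br_simps ric
  have s11: "2 * a * z - c\<^sup>2 / 2 = l"
    using s [of e1 e1] by (simp add: simps)
  have s12: "c * z = 0"
    using s [of e1 e2] by (auto simp: simps)
  have s13: "a * x + b * z + c * y + a * c = 0"
    using s [of e1 e3] by (simp add: simps algebra_simps)
  have s23: "d * z + c\<^sup>2 / 2 = l"
    using s [of e2 e3] by (simp add: simps algebra_simps)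
  have s33: "2 * b * x + 2 * d * y + a * d - a\<^sup>2 - b * c = 0"
    using s [of e3 e3] by (simp add: simps algebra_simps)
  \<comment> \<open>If c were nonzero, \<open>s12\<close> would give \<open>z = 0\<close>, and
    \<open>s11\<close>, \<open>s23\<close> would then equate l with both \<open>- c^2 / 2\<close>
    and \<open>c^2 / 2\<close>.\<close>
  have "c = 0"
    using s11 s12 s23 ac by auto
  moreover have "a \<noteq> 0"
  proof
    assume "a = 0"
    then have "einstein br g"
      using \<open>c = 0\<close> by (intro einsteinI [OF basis, of 0]) (simp add: ric)
    then show False
      using assms by simp
  qed
  \<comment> \<open>For \<open>d = 0\<close> the equations successively give \<open>l = 0\<close>,
    \<open>z = 0\<close> and \<open>x = 0\<close>, so \<open>s33\<close> becomes
    \<open>a^2 = 0\<close>.\<close>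
  moreover have "d \<noteq> 0"
    using calculation s11 s13 s23 s33 by auto
  ultimately show ?thesis
    by simp
qed

text \<open>The four equations are the components (1,1), (2,3), (1,3) and (3,3); the components
  (1,2) and (2,2) hold identically once \<open>c = 0\<close>. The first two leave either
  \<open>z = 0\<close>, hence \<open>l = 0\<close>, or \<open>d = 2 * a\<close> with l free.\<close>

lemma null_frame_solitonI:
  assumes br: "type_IV_brackets br e1 e2 e3 a b 0 d"
    and e: "g e1 e1 = 1" "g e2 e2 = 0" "g e3 e3 = 0" "g e1 e2 = 0" "g e1 e3 = 0" "g e2 e3 = -1"
    and "2 * a * z = l" "d * z = l" "a * x + b * z = 0" "2 * b * x + 2 * d * y = a\<^sup>2 - a * d"
  shows "ricci_soliton br g (x *\<^sub>R e1 + y *\<^sub>R e2 + z *\<^sub>R e3) l"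
proof -
  have basis: "basis3 e1 e2 e3"
    using br by (simp_all add: type_IV_brackets_def)
  have e': "g e2 e1 = 0" "g e3 e1 = 0" "g e3 e2 = -1"
    using e g_commute by metis+
  show ?thesis
    using assms(8-)
    by (intro ricci_solitonI [OF basis])
      (simp add: lie_derivative_metric_def type_IV_bracketsD [OF br] e e' g_simps br_simps
        null_frame_ricci [OF br e] algebra_simps)
qed

section \<open>Non-triviality in type IV.3\<close>

lemma null_frame_einstein_imp_constant_curvature:
  assumes br: "type_IV_brackets br e1 e2 e3 a b 0 d"
    and e: "g e1 e1 = 1" "g e2 e2 = 0" "g e3 e3 = 0" "g e1 e2 = 0" "g e1 e3 = 0" "g e2 e3 = -1"
    and "a \<noteq> 0" and "einstein br g"
  shows "constant_sectional_curvature br g"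
proof -
  have basis: "basis3 e1 e2 e3"
    using br by (simp_all add: type_IV_brackets_def)
  obtain k where "\<forall>x y. ricci br g x y = k * g x y"
    using \<open>einstein br g\<close> by (auto simp: einstein_def)
  then have "ricci br g e1 e1 = k * g e1 e1" "ricci br g e3 e3 = k * g e3 e3"
    by blast+
  \<comment> \<open>The (1,1) component makes the Einstein constant zero, and then the (3,3)
    component reads \<open>a * (d - a) = 0\<close>.\<close>
  then have d: "d = a"
    using \<open>a \<noteq> 0\<close> by (simp add: null_frame_ricci [OF br e] e power2_eq_square)
  have "R x y z = 0" for x y z
  proof -
    obtain x1 x2 x3 where x: "x = x1 *\<^sub>R e1 + x2 *\<^sub>R e2 + x3 *\<^sub>R e3"
      using basis3_cases [OF basis] .
    obtain y1 y2 y3 where y: "y = y1 *\<^sub>R e1 + y2 *\<^sub>R e2 + y3 *\<^sub>R e3"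
      using basis3_cases [OF basis] .
    obtain z1 z2 z3 where z: "z = z1 *\<^sub>R e1 + z2 *\<^sub>R e2 + z3 *\<^sub>R e3"
      using basis3_cases [OF basis] .
    show ?thesis
      by (simp add: x y z R_eq D_simps null_frame_connection [OF br e] type_IV_bracketsD [OF br] d
          br_simps algebra_simps)
  qed
  then show ?thesis
    by (auto simp: constant_sectional_curvature_def sectional_curvature_def g_simps)
qed

lemma null_frame_not_product:
  assumes br: "type_IV_brackets br e1 e2 e3 a b 0 d"
    and e: "g e1 e1 = 1" "g e2 e2 = 0" "g e3 e3 = 0" "g e1 e2 = 0" "g e1 e3 = 0" "g e2 e3 = -1"
    and "a \<noteq> 0"
  shows "\<not> product_line_surface br g"
proof
  assume "product_line_surface br g"
  then obtain u where u: "g u u \<noteq> 0" "D e1 u = 0"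
    by (auto simp: product_line_surface_def)
  have e': "g e2 e1 = 0" "g e3 e1 = 0" "g e3 e2 = -1"
    using e g_commute by metis+
  have "basis3 e1 e2 e3"
    using br by (simp add: type_IV_brackets_def)
  then obtain x y z where X: "u = x *\<^sub>R e1 + y *\<^sub>R e2 + z *\<^sub>R e3"
    using basis3_cases by blast
  have "g (D e1 u) v = 0" for v
    by (simp add: u g_simps)
  \<comment> \<open>The two inner products are \<open>a * z\<close> and \<open>- a * x\<close>; what
    remains of u is a multiple of the null vector \<open>e2\<close>.\<close>
  from this [of e1] this [of e3] have "z = 0" "x = 0"
    using \<open>a \<noteq> 0\<close> by (simp_all add: X D_simps null_frame_connection [OF br e] g_simps e e')
  then show False
    using u by (simp add: X g_simps e)
qed

end

section \<open>The equivalence and the explicit soliton fields\<close>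

theorem theorem7:
  fixes br :: "'a::real_vector \<Rightarrow> 'a \<Rightarrow> 'a"
    and g :: "'a \<Rightarrow> 'a \<Rightarrow> real"
  assumes "dim (UNIV :: 'a set) = 3"
    and "lie_bracket br"
    and "\<not> unimodular br"
    and "lorentzian3 g"
    and "in_classification br g"
  shows
    "(nontrivial_homogeneous_soliton br g \<longleftrightarrow>
        \<not> constant_sectional_curvature br g \<and>
        (\<exists>e1 e2 e3 \<alpha> \<beta> \<gamma> \<delta>. type_IV3 br g e1 e2 e3 \<alpha> \<beta> \<gamma> \<delta> \<and> \<alpha> \<noteq> 0 \<and> \<gamma> = 0 \<and> \<delta> \<noteq> 0)) \<and>
     (\<forall>e1 e2 e3 \<alpha> \<beta> \<gamma> \<delta>. type_IV3 br g e1 e2 e3 \<alpha> \<beta> \<gamma> \<delta> \<and> \<alpha> \<noteq> 0 \<and> \<gamma> = 0 \<and> \<delta> \<noteq> 0 \<longrightarrow>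
        (let f1 = e1;
             f2 = (1 / sqrt 2) *\<^sub>R (e2 - e3);
             f3 = (1 / sqrt 2) *\<^sub>R (e2 + e3)
         in
           (let X = ((\<alpha>\<^sup>2 - \<alpha> * \<delta>) / (2 * sqrt 2 * \<delta>)) *\<^sub>R (f2 + f3)
            in causal_character g X = Null \<and> steady_soliton br g X) \<and>
           (\<delta> = 2 * \<alpha> \<longrightarrow>
             (let X = (\<lambda>l::real.
                    - (2 * \<beta> * l / \<delta>\<^sup>2) *\<^sub>R f1
                    - ((\<delta> ^ 4 + 8 * (\<delta>\<^sup>2 - 2 * \<beta>\<^sup>2) * l) / (8 * sqrt 2 * \<delta> ^ 3)) *\<^sub>R f2
                    - ((\<delta> ^ 4 - 8 * (\<delta>\<^sup>2 + 2 * \<beta>\<^sup>2) * l) / (8 * sqrt 2 * \<delta> ^ 3)) *\<^sub>R f3)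
              in (\<forall>l. ricci_soliton br g (X l) l \<and>
                    causal_character g (X l) =
                      (if l > 0 then Spacelike else if l < 0 then Timelike else Null)) \<and>
                 (\<exists>l. expanding_soliton br g (X l)) \<and>
                 (\<exists>l. steady_soliton br g (X l)) \<and>
                 (\<exists>l. shrinking_soliton br g (X l))))))"
proof -
  interpret lorentzian_lie_algebra br g
    by unfold_locales (use assms in auto)
  let ?special = "\<lambda>e1 e2 e3 \<alpha> \<beta> \<gamma> \<delta>. type_IV3 br g e1 e2 e3 \<alpha> \<beta> \<gamma> \<delta> \<and> \<alpha> \<noteq> 0 \<and> \<gamma> = 0 \<and> \<delta> \<noteq> 0"
  have frame: "type_IV_brackets br e1 e2 e3 \<alpha> \<beta> 0 \<delta>"
      "g e1 e1 = 1" "g e2 e2 = 0" "g e3 e3 = 0" "g e1 e2 = 0" "g e1 e3 = 0" "g e2 e3 = -1"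
      "\<alpha> \<noteq> 0" "\<delta> \<noteq> 0"
    if "?special e1 e2 e3 \<alpha> \<beta> \<gamma> \<delta>" for e1 e2 e3 \<alpha> \<beta> \<gamma> \<delta>
    using that by (auto simp: type_IV3_def)
  have steady: "ricci_soliton br g (((\<alpha>\<^sup>2 - \<alpha> * \<delta>) / (2 * \<delta>)) *\<^sub>R e2) 0"
    if "?special e1 e2 e3 \<alpha> \<beta> \<gamma> \<delta>" for e1 e2 e3 \<alpha> \<beta> \<gamma> \<delta>
    using null_frame_solitonI [OF frame(1-7) [OF that], where l = 0 and z = 0 and x = 0
        and y = "(\<alpha>\<^sup>2 - \<alpha> * \<delta>) / (2 * \<delta>)"] frame(9) [OF that]
    by simp
  have special_nontrivial: "nontrivial_homogeneous_soliton br g"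
    if "\<not> constant_sectional_curvature br g" "?special e1 e2 e3 \<alpha> \<beta> \<gamma> \<delta>" for e1 e2 e3 \<alpha> \<beta> \<gamma> \<delta>
    unfolding nontrivial_homogeneous_soliton_def
    using steady [OF that(2)] that(1)
      null_frame_einstein_imp_constant_curvature [OF frame(1-8) [OF that(2)]]
      null_frame_not_product [OF frame(1-8) [OF that(2)]]
    by blast
  have nontrivial_special: "\<exists>e1 e2 e3 \<alpha> \<beta> \<gamma> \<delta>. ?special e1 e2 e3 \<alpha> \<beta> \<gamma> \<delta>"
    and nontrivial_curvature: "\<not> constant_sectional_curvature br g"
    if nontrivial: "nontrivial_homogeneous_soliton br g"
  proof -
    obtain X l where X: "ricci_soliton br g X l" and not_einstein: "\<not> einstein br g"
      using nontrivial by (auto simp: nontrivial_homogeneous_soliton_def)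
    \<comment> \<open>A non-trivial soliton is not Einstein, so its curvature is not constant and
      the classification applies.\<close>
    show curv: "\<not> constant_sectional_curvature br g"
      using not_einstein constant_curvature_imp_einstein by blast
    obtain e1 e2 e3 \<alpha> \<beta> \<gamma> \<delta> where "type_IV1 br g e1 e2 e3 \<alpha> \<beta> \<gamma> \<delta> \<or>
        type_IV2 br g e1 e2 e3 \<alpha> \<beta> \<gamma> \<delta> \<or> type_IV3 br g e1 e2 e3 \<alpha> \<beta> \<gamma> \<delta>"
      using assms(5) curv unfolding in_classification_def by blast
    moreover have "\<not> type_IV1 br g e1 e2 e3 \<alpha> \<beta> \<gamma> \<delta>"
      using orthonormal_frame_soliton_imp_einstein [of e1 e2 e3 \<alpha> \<beta> \<gamma> \<delta> "-1" X l] X not_einstein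
      by (auto simp: type_IV1_def)
    moreover have "\<not> type_IV2 br g e1 e2 e3 \<alpha> \<beta> \<gamma> \<delta>"
      using orthonormal_frame_soliton_imp_einstein [of e1 e2 e3 \<alpha> \<beta> \<gamma> \<delta> 1 X l] X not_einstein
      by (auto simp: type_IV2_def)
    ultimately have "type_IV3 br g e1 e2 e3 \<alpha> \<beta> \<gamma> \<delta>"
      by blast
    moreover from this have "\<alpha> \<noteq> 0 \<and> \<gamma> = 0 \<and> \<delta> \<noteq> 0"
      unfolding type_IV3_def
      using null_frame_soliton_cases [of e1 e2 e3 \<alpha> \<beta> \<gamma> \<delta> X l] X not_einstein by blast
    ultimately show "\<exists>e1 e2 e3 \<alpha> \<beta> \<gamma> \<delta>. ?special e1 e2 e3 \<alpha> \<beta> \<gamma> \<delta>"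
      by blast
  qed
  have sqrt2: "q / (8 * sqrt 2 * r) * (1 / sqrt 2) = q / (16 * r)" for q r :: real
    by simp
  have null_field: "((\<alpha>\<^sup>2 - \<alpha> * \<delta>) / (2 * sqrt 2 * \<delta>)) *\<^sub>R
      ((1 / sqrt 2) *\<^sub>R (e2 - e3) + (1 / sqrt 2) *\<^sub>R (e2 + e3)) = ((\<alpha>\<^sup>2 - \<alpha> * \<delta>) / (2 * \<delta>)) *\<^sub>R e2"
    for \<alpha> \<delta> and e2 e3 :: 'a
  proof -
    have "(1 / sqrt 2) *\<^sub>R (e2 - e3) + (1 / sqrt 2) *\<^sub>R (e2 + e3) = (2 / sqrt 2) *\<^sub>R e2"
      by (simp add: scaleR_right_distrib scaleR_right_diff_distrib flip: scaleR_left_distrib)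
    moreover have "q / (2 * sqrt 2 * \<delta>) * (2 / sqrt 2) = q / (2 * \<delta>)" for q
      by (simp add: field_simps)
    ultimately show ?thesis
      by (simp only: scaleR_scaleR)
  qed
  \<comment> \<open>This keeps the literal form of the family in the goal, so that the definition
    can be folded there.\<close>
  define X where "X e1 e2 e3 \<beta> \<delta> l =
      - (2 * \<beta> * l / \<delta>\<^sup>2) *\<^sub>R e1
      - ((\<delta> ^ 4 + 8 * (\<delta>\<^sup>2 - 2 * \<beta>\<^sup>2) * l) / (8 * sqrt 2 * \<delta> ^ 3)) *\<^sub>R ((1 / sqrt 2) *\<^sub>R (e2 - e3))
      - ((\<delta> ^ 4 - 8 * (\<delta>\<^sup>2 + 2 * \<beta>\<^sup>2) * l) / (8 * sqrt 2 * \<delta> ^ 3)) *\<^sub>R ((1 / sqrt 2) *\<^sub>R (e2 + e3))"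
    for e1 e2 e3 :: 'a and \<beta> \<delta> l :: real
  \<comment> \<open>In the null frame the coefficients are the solution of the four equations of
    \<open>null_frame_solitonI\<close> for \<open>\<alpha> = \<delta> / 2\<close>: z from the first
    two, then x, then y.\<close>
  have X: "X e1 e2 e3 \<beta> \<delta> l = (- 2 * \<beta> * l / \<delta>\<^sup>2) *\<^sub>R e1
      + ((16 * \<beta>\<^sup>2 * l - \<delta> ^ 4) / (8 * \<delta> ^ 3)) *\<^sub>R e2 + (l / \<delta>) *\<^sub>R e3"
    if "\<delta> \<noteq> 0" for e1 e2 e3 \<beta> \<delta> l
  proof -
    let ?A = "\<delta> ^ 4 + 8 * (\<delta>\<^sup>2 - 2 * \<beta>\<^sup>2) * l" and ?B = "\<delta> ^ 4 - 8 * (\<delta>\<^sup>2 + 2 * \<beta>\<^sup>2) * l"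
    have "X e1 e2 e3 \<beta> \<delta> l = (- 2 * \<beta> * l / \<delta>\<^sup>2) *\<^sub>R e1
        + (- (?A / (16 * \<delta> ^ 3)) - ?B / (16 * \<delta> ^ 3)) *\<^sub>R e2
        + (?A / (16 * \<delta> ^ 3) - ?B / (16 * \<delta> ^ 3)) *\<^sub>R e3"
      unfolding X_def scaleR_scaleR sqrt2
      by (simp only: scaleR_left_distrib scaleR_left_diff_distrib scaleR_right_distrib
          scaleR_right_diff_distrib scaleR_minus_left) simp
    also have "- (?A / (16 * \<delta> ^ 3)) - ?B / (16 * \<delta> ^ 3) = (16 * \<beta>\<^sup>2 * l - \<delta> ^ 4) / (8 * \<delta> ^ 3)"
      using that by (simp add: field_simps)
    also have "?A / (16 * \<delta> ^ 3) - ?B / (16 * \<delta> ^ 3) = l / \<delta>"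
      using that by (simp add: field_simps power2_eq_square power3_eq_cube)
    finally show ?thesis .
  qed
  have X_soliton: "ricci_soliton br g (X e1 e2 e3 \<beta> \<delta> l) l"
    \<comment> \<open>In coordinates the norm is \<open>x^2 - 2 * y * z\<close>, where the terms
      with \<beta> cancel. Hence the causal character is decided by the sign of l alone.\<close>
    and X_norm: "g (X e1 e2 e3 \<beta> \<delta> l) (X e1 e2 e3 \<beta> \<delta> l) = l / 4"
    if "?special e1 e2 e3 \<alpha> \<beta> \<gamma> \<delta>" "\<delta> = 2 * \<alpha>" for e1 e2 e3 \<alpha> \<beta> \<gamma> \<delta> l
  proof -
    have \<alpha>: "\<alpha> = \<delta> / 2" and \<delta>: "\<delta> \<noteq> 0"
      using that by auto
    note f = frame(1-7) [OF that(1)]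
    have f': "g e2 e1 = 0" "g e3 e1 = 0" "g e3 e2 = -1"
      using f g_commute by metis+
    show "ricci_soliton br g (X e1 e2 e3 \<beta> \<delta> l) l"
      unfolding X [OF \<delta>] using \<delta>
      by (intro null_frame_solitonI [OF f])
        (simp_all add: \<alpha> field_simps power2_eq_square power3_eq_cube power4_eq_xxxx)
    show "g (X e1 e2 e3 \<beta> \<delta> l) (X e1 e2 e3 \<beta> \<delta> l) = l / 4"
      using \<delta>
      by (simp add: X g_simps f f' field_simps power2_eq_square power3_eq_cube power4_eq_xxxx)
  qed
  show ?thesis
    unfolding Let_def null_field X_def [symmetric]
  proof (intro conjI allI impI iffI)
    fix e1 e2 e3 \<alpha> \<beta> \<gamma> \<delta>
    assume special: "?special e1 e2 e3 \<alpha> \<beta> \<gamma> \<delta>"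
    show "causal_character g (((\<alpha>\<^sup>2 - \<alpha> * \<delta>) / (2 * \<delta>)) *\<^sub>R e2) = Null"
      using frame(3) [OF special] by (simp add: causal_character_def g_simps)
    show "steady_soliton br g (((\<alpha>\<^sup>2 - \<alpha> * \<delta>) / (2 * \<delta>)) *\<^sub>R e2)"
      unfolding steady_soliton_def by (rule steady [OF special])
    assume \<delta>: "\<delta> = 2 * \<alpha>"
    note X_soliton = X_soliton [OF special \<delta>]
    show "ricci_soliton br g (X e1 e2 e3 \<beta> \<delta> l) l" for l
      by (rule X_soliton)
    show "causal_character g (X e1 e2 e3 \<beta> \<delta> l) =
        (if l > 0 then Spacelike else if l < 0 then Timelike else Null)" for l
      by (simp add: causal_character_def X_norm [OF special \<delta>])
    show "\<exists>l. expanding_soliton br g (X e1 e2 e3 \<beta> \<delta> l)"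
      using X_soliton [of "-1"] unfolding expanding_soliton_def
      by (metis neg_less_0_iff_less zero_less_one)
    show "\<exists>l. steady_soliton br g (X e1 e2 e3 \<beta> \<delta> l)"
      using X_soliton [of 0] unfolding steady_soliton_def by blast
    show "\<exists>l. shrinking_soliton br g (X e1 e2 e3 \<beta> \<delta> l)"
      using X_soliton [of 1] unfolding shrinking_soliton_def by (metis zero_less_one)
  qed (use nontrivial_special nontrivial_curvature special_nontrivial in \<open>blast+\<close>)
qed

end
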